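(* Let $X$ be a complex Banach space, let $N\ge 1$, and let $\theta_1,\dots,\theta_N\in[0,2\pi)$ be distinct angles. For $0\le\theta<2\pi$ write $R_\theta=\{re^{i\theta} : r\ge 0\}\subset\mathbb{C}$. Suppose that $\{\lambda_{n,m} : n=1,\dots,N,\ m=1,2,\dots\}\subset\mathbb{C}$ are scalars and $\{E_{n,m} : n=1,\dots,N,\ m=1,2,\dots\}\subset B(X)$ are projections satisfying: (1) for each $n=1,\dots,N$, $\{\lambda_{n,m}\}_{m=1}^\infty\subset R_{\theta_n}$; (2) for each $n=1,\dots,N$, $|\lambda_{n,1}|>|\lambda_{n,2}|>|\lambda_{n,3}|>\cdots$, and $\lambda_{n,m}\to 0$ as $m\to\infty$; (3) the operators $E_{n,m}$ are pairwise disjoint finite rank projections, and there exists a constant $K$ such that $\bigl\|\sum_{m=1}^M E_{n,m}\bigr\|\le K$ for each $n=1,\dots,N$ and each $M=1,2,\dots$. Let $\sigma=\{0\}\cup\{\lambda_{n,m} : n=1,\dots,N,\ m=1,2,\dots\}$. Order the index set by declaring that $(n,m)\succ(s,t)$ (that is, $(n,m)$ comes after $(s,t)$) if $|\lambda_{n,m}|<|\lambda_{s,t}|$, or if $|\lambda_{n,m}|=|\lambda_{s,t}|$ and $\theta_n>\theta_s$. Then the series $$T=\sum_{n,m}\lambda_{n,m}E_{n,m},$$ with the terms summed in the order $\succ$, converges in operator norm to a compact $AC(\sigma)$ operator.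
   Context: $B(X)$ is the algebra of bounded linear operators on $X$. Projections $E,F$ are disjoint if $EF=FE=0$. Definitions of $BV(\sigma)$ and $AC(\sigma)$. Let $\sigma\subset\mathbb{C}$ be nonempty and compact. For a piecewise linear curve $\gamma:[0,1]\to\mathbb{C}$ (continuous, and affine on each interval of some finite partition of $[0,1]$) and a (real) line $\ell$ in the plane, an entry point of $\gamma$ on $\ell$ is a parameter $t\in[0,1]$ with $\gamma(t)\in\ell$ such that either $t=0$, or for every $\epsilon>0$ there is $s\in(t-\epsilon,t)\cap[0,1]$ with $\gamma(s)\notin\ell$. The variation factor $\operatorname{vf}(\gamma)$ is the maximum over all lines $\ell$ of the number of entry points of $\gamma$ on $\ell$, and $\rho(\gamma)=1/\operatorname{vf}(\gamma)$. For $f:\sigma\to\mathbb{C}$, $\operatorname{cvar}(f,\gamma)$ is the supremum of $\sum_{i=1}^{k-1}|f(\gamma(s_{i+1}))-f(\gamma(s_i))|$ over all finite lists $0\le s_1<\dots<s_k\le 1$ with all $\gamma(s_i)\in\sigma$ (zero if there are none). Set $\operatorname{var}(f,\sigma)=\sup_\gamma \operatorname{cvar}(f,\gamma)\rho(\gamma)$, the supremum being over all piecewise linear curves, and $\|f\|_{BV(\sigma)}=\sup_\sigma|f|+\operatorname{var}(f,\sigma)$. $BV(\sigma)$ is the Banach algebra of functions with $\|f\|_{BV(\sigma)}<\infty$, and $AC(\sigma)$ is the closure in $BV(\sigma)$ of the polynomials in $z$ and $\overline{z}$ (restricted to $\sigma$). An operator $T\in B(X)$ is an $AC(\sigma)$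 operator if it admits an $AC(\sigma)$ functional calculus, i.e. there is a continuous unital algebra homomorphism $\Psi:AC(\sigma)\to B(X)$ with $\Psi(\boldsymbol{\lambda})=T$, where $\boldsymbol{\lambda}(z)=z$. *)

theory Defs
  imports "HOL-Analysis.Analysis"
begin

section \<open>Complex normed spaces and their operators\<close>

class scaleC =
  fixes scaleC :: "complex \<Rightarrow> 'a \<Rightarrow> 'a" (infixr \<open>*\<^sub>C\<close> 75)

class complex_normed_vector = real_normed_vector + scaleC +
  assumes scaleC_add_right: "a *\<^sub>C (x + y) = a *\<^sub>C x + a *\<^sub>C y"
    and scaleC_add_left: "(a + b) *\<^sub>C x = a *\<^sub>C x + b *\<^sub>C x"
    and scaleC_scaleC: "a *\<^sub>C b *\<^sub>C x = (a * b) *\<^sub>C x"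
    and scaleR_eq_scaleC: "r *\<^sub>R x = complex_of_real r *\<^sub>C x"
    and norm_scaleC: "norm (a *\<^sub>C x) = cmod a * norm x"

class complex_banach = complex_normed_vector + banach

lemma vector_space_scaleC:
  "vector_space (scaleC :: complex \<Rightarrow> 'a \<Rightarrow> 'a::complex_normed_vector)"
proof
  show "1 *\<^sub>C x = x" for x :: 'a
    using scaleR_eq_scaleC[of 1 x] by simp
qed (simp_all add: scaleC_add_right scaleC_add_left scaleC_scaleC)

lemma bounded_linear_scaleC:
  "bounded_linear (\<lambda>x :: 'a::complex_normed_vector. c *\<^sub>C x)"
proof (rule bounded_linear_intro[where K = "cmod c"])
  show "c *\<^sub>C (r *\<^sub>R x) = r *\<^sub>R (c *\<^sub>C x)" for r and x :: 'a
    by (simp add: scaleR_eq_scaleC scaleC_scaleC mult.commute)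
qed (simp_all add: scaleC_add_right norm_scaleC mult.commute)

instantiation blinfun :: (real_normed_vector, complex_normed_vector) complex_normed_vector
begin

lift_definition scaleC_blinfun :: "complex \<Rightarrow> 'a \<Rightarrow>\<^sub>L 'b \<Rightarrow> 'a \<Rightarrow>\<^sub>L 'b"
  is "\<lambda>c A x. c *\<^sub>C A x"
  by (rule bounded_linear_compose[OF bounded_linear_scaleC])

instance
proof
  fix a b :: complex and r :: real and x y :: "'a \<Rightarrow>\<^sub>L 'b"
  show "a *\<^sub>C (x + y) = a *\<^sub>C x + a *\<^sub>C y"
    by transfer (simp add: scaleC_add_right)
  show "(a + b) *\<^sub>C x = a *\<^sub>C x + b *\<^sub>C x"
    by transfer (simp add: scaleC_add_left)
  show "a *\<^sub>C b *\<^sub>C x = (a * b) *\<^sub>C x"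
    by transfer (simp add: scaleC_scaleC)
  show "r *\<^sub>R x = complex_of_real r *\<^sub>C x"
    by transfer (simp add: scaleR_eq_scaleC)
  have le: "norm (c *\<^sub>C z) \<le> cmod c * norm z" for c and z :: "'a \<Rightarrow>\<^sub>L 'b"
  proof (rule norm_blinfun_bound)
    show "norm (blinfun_apply (c *\<^sub>C z) v) \<le> cmod c * norm z * norm v" for v
      using norm_blinfun[of z v]
      by (simp add: scaleC_blinfun.rep_eq norm_scaleC mult.assoc mult_left_mono)
  qed simp
  have one: "1 *\<^sub>C z = z" for z :: "'a \<Rightarrow>\<^sub>L 'b"
    by transfer (simp add: vector_space.vector_space_assms(4)[OF vector_space_scaleC])
  show "norm (a *\<^sub>C x) = cmod a * norm x"
  proof (cases "a = 0")
    case True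
    then show ?thesis using le[of 0 x] by simp
  next
    case False
    have "x = inverse a *\<^sub>C (a *\<^sub>C x)"
      using False one by transfer (simp add: scaleC_scaleC)
    then have "norm x \<le> inverse (cmod a) * norm (a *\<^sub>C x)"
      using le[of "inverse a" "a *\<^sub>C x"] by (simp add: norm_inverse)
    then have "cmod a * norm x \<le> norm (a *\<^sub>C x)"
      using False by (simp add: field_simps)
    then show ?thesis using le[of a x] by simp
  qed
qed

end

text \<open>The type of bounded linear maps consists of the real-linear ones; the algebra $B(X)$
  of the complex space is the closed subalgebra of the complex-linear ones, with the same norm.\<close>

definition bounded_ops :: "('a::complex_normed_vector \<Rightarrow>\<^sub>L 'a) set" where
  "bounded_ops = {A. \<forall>c x. blinfun_apply A (c *\<^sub>C x) = c *\<^sub>C blinfun_apply A x}"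

definition is_projection :: "('a::complex_normed_vector \<Rightarrow>\<^sub>L 'a) \<Rightarrow> bool" where
  "is_projection P \<longleftrightarrow> P \<in> bounded_ops \<and> P o\<^sub>L P = P"

definition disjoint_ops :: "('a::complex_normed_vector \<Rightarrow>\<^sub>L 'a) \<Rightarrow> ('a \<Rightarrow>\<^sub>L 'a) \<Rightarrow> bool" where
  "disjoint_ops P Q \<longleftrightarrow> P o\<^sub>L Q = 0 \<and> Q o\<^sub>L P = 0"

definition finite_rank :: "('a::complex_normed_vector \<Rightarrow>\<^sub>L 'a) \<Rightarrow> bool" where
  "finite_rank A \<longleftrightarrow> (\<exists>B. finite B \<and> range (blinfun_apply A) \<subseteq> module.span scaleC B)"

definition compact_operator :: "('a::complex_normed_vector \<Rightarrow>\<^sub>L 'a) \<Rightarrow> bool" where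
  "compact_operator A \<longleftrightarrow> A \<in> bounded_ops \<and> compact (closure (blinfun_apply A ` cball 0 1))"

section \<open>Variation over piecewise linear curves\<close>

definition piecewise_linear_curve :: "(real \<Rightarrow> complex) \<Rightarrow> bool" where
  "piecewise_linear_curve \<gamma> \<longleftrightarrow> continuous_on {0..1} \<gamma> \<and>
     (\<exists>(n::nat) u. u 0 = 0 \<and> u n = 1 \<and>
        (\<forall>i<n. u i < u (Suc i) \<and> (\<exists>a b. \<forall>t\<in>{u i..u (Suc i)}. \<gamma> t = a + t *\<^sub>R b)))"

definition plane_lines :: "complex set set" where
  "plane_lines = {range (\<lambda>t::real. a + t *\<^sub>R d) | a d. d \<noteq> 0}"

definition entry_points :: "(real \<Rightarrow> complex) \<Rightarrow> complex set \<Rightarrow> real set" where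
  "entry_points \<gamma> l = {t \<in> {0..1}. \<gamma> t \<in> l \<and>
     (t = 0 \<or> (\<forall>\<epsilon>>0. \<exists>s \<in> {t - \<epsilon><..<t} \<inter> {0..1}. \<gamma> s \<notin> l))}"

text \<open>On piecewise linear curves the numbers of entry points are finite and uniformly bounded
  (see below), so that the maximum exists.\<close>

definition vf :: "(real \<Rightarrow> complex) \<Rightarrow> nat" where
  "vf \<gamma> = Max {card (entry_points \<gamma> l) | l. l \<in> plane_lines}"

definition cvar :: "complex set \<Rightarrow> (complex \<Rightarrow> complex) \<Rightarrow> (real \<Rightarrow> complex) \<Rightarrow> ennreal" where
  "cvar \<sigma> f \<gamma> = (SUP s \<in> {s. sorted_wrt (<) s \<and> (\<forall>t \<in> set s. t \<in> {0..1} \<and> \<gamma> t \<in> \<sigma>)}.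
     \<Sum>i<length s - 1. ennreal (cmod (f (\<gamma> (s ! Suc i)) - f (\<gamma> (s ! i)))))"

definition var :: "complex set \<Rightarrow> (complex \<Rightarrow> complex) \<Rightarrow> ennreal" where
  "var \<sigma> f = (SUP \<gamma> \<in> {\<gamma>. piecewise_linear_curve \<gamma>}. cvar \<sigma> f \<gamma> * ennreal (1 / real (vf \<gamma>)))"

definition BV_norm :: "complex set \<Rightarrow> (complex \<Rightarrow> complex) \<Rightarrow> ennreal" where
  "BV_norm \<sigma> f = (SUP z \<in> \<sigma>. ennreal (cmod (f z))) + var \<sigma> f"

section \<open>The function algebras and their functional calculus\<close>

text \<open>A function on $\sigma$ is represented by its extension by zero to the whole plane, so that
  equality of representatives is equality on $\sigma$.\<close>

definition restr :: "complex set \<Rightarrow> (complex \<Rightarrow> complex) \<Rightarrow> complex \<Rightarrow> complex" where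
  "restr \<sigma> f = (\<lambda>z. if z \<in> \<sigma> then f z else 0)"

definition BV :: "complex set \<Rightarrow> (complex \<Rightarrow> complex) set" where
  "BV \<sigma> = {f. (\<forall>z. z \<notin> \<sigma> \<longrightarrow> f z = 0) \<and> BV_norm \<sigma> f < \<infinity>}"

definition polys :: "complex set \<Rightarrow> (complex \<Rightarrow> complex) set" where
  "polys \<sigma> = {restr \<sigma> (\<lambda>z. \<Sum>j\<le>d. \<Sum>k\<le>d. c j k * z ^ j * cnj z ^ k) | (d::nat) c. True}"

definition AC :: "complex set \<Rightarrow> (complex \<Rightarrow> complex) set" where
  "AC \<sigma> = {f \<in> BV \<sigma>. \<forall>\<epsilon>>0. \<exists>p \<in> polys \<sigma>. BV_norm \<sigma> (\<lambda>z. f z - p z) < ennreal \<epsilon>}"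

definition AC_functional_calculus ::
  "complex set \<Rightarrow> ((complex \<Rightarrow> complex) \<Rightarrow> 'a::complex_normed_vector \<Rightarrow>\<^sub>L 'a) \<Rightarrow> bool" where
  "AC_functional_calculus \<sigma> \<Psi> \<longleftrightarrow>
     (\<forall>f \<in> AC \<sigma>. \<Psi> f \<in> bounded_ops) \<and>
     (\<forall>f \<in> AC \<sigma>. \<forall>g \<in> AC \<sigma>. \<Psi> (\<lambda>z. f z + g z) = \<Psi> f + \<Psi> g) \<and>
     (\<forall>c. \<forall>f \<in> AC \<sigma>. \<Psi> (\<lambda>z. c * f z) = c *\<^sub>C \<Psi> f) \<and>
     (\<forall>f \<in> AC \<sigma>. \<forall>g \<in> AC \<sigma>. \<Psi> (\<lambda>z. f z * g z) = \<Psi> f o\<^sub>L \<Psi> g) \<and>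
     \<Psi> (restr \<sigma> (\<lambda>z. 1)) = id_blinfun \<and>
     (\<forall>f \<in> AC \<sigma>. \<forall>\<epsilon>>0. \<exists>\<delta>>0. \<forall>g \<in> AC \<sigma>.
        BV_norm \<sigma> (\<lambda>z. g z - f z) < ennreal \<delta> \<longrightarrow> norm (\<Psi> g - \<Psi> f) < \<epsilon>)"

definition AC_operator :: "complex set \<Rightarrow> ('a::complex_normed_vector \<Rightarrow>\<^sub>L 'a) \<Rightarrow> bool" where
  "AC_operator \<sigma> T \<longleftrightarrow> T \<in> bounded_ops \<and>
     (\<exists>\<Psi>. AC_functional_calculus \<sigma> \<Psi> \<and> \<Psi> (restr \<sigma> (\<lambda>z. z)) = T)"

section \<open>Rays and the order of summation\<close>

definition ray :: "real \<Rightarrow> complex set" where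
  "ray \<theta> = {complex_of_real r * exp (\<i> * complex_of_real \<theta>) | r. r \<ge> 0}"

definition comes_after ::
  "(nat \<Rightarrow> nat \<Rightarrow> complex) \<Rightarrow> (nat \<Rightarrow> real) \<Rightarrow> nat \<times> nat \<Rightarrow> nat \<times> nat \<Rightarrow> bool" where
  "comes_after lam \<theta> = (\<lambda>(n, m) (s, t). cmod (lam n m) < cmod (lam s t) \<or>
     (cmod (lam n m) = cmod (lam s t) \<and> \<theta> n > \<theta> s))"

text \<open>An enumeration of the index set by the natural numbers that respects the order;
  there is at most one.\<close>

definition ordered_enumeration ::
  "nat \<Rightarrow> (nat \<Rightarrow> nat \<Rightarrow> complex) \<Rightarrow> (nat \<Rightarrow> real) \<Rightarrow> (nat \<Rightarrow> nat \<times> nat) \<Rightarrow> bool" where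
  "ordered_enumeration N lam \<theta> e \<longleftrightarrow> bij_betw e UNIV ({1..N} \<times> {1..}) \<and>
     (\<forall>i j. i < j \<longrightarrow> comes_after lam \<theta> (e j) (e i))"

section \<open>The variation factor is well defined\<close>

lemma entry_points_bounded:
  assumes "piecewise_linear_curve \<gamma>"
  shows "\<exists>n. \<forall>l \<in> plane_lines. finite (entry_points \<gamma> l) \<and> card (entry_points \<gamma> l) \<le> n"
proof -
  obtain n u where u: "u 0 = 0" "u n = (1::real)"
    and step: "\<forall>i<n. u i < u (Suc i) \<and> (\<exists>a b. \<forall>t\<in>{u i..u (Suc i)}. \<gamma> t = a + t *\<^sub>R b)"
    using assms unfolding piecewise_linear_curve_def by blast
  have "finite (entry_points \<gamma> l) \<and> card (entry_points \<gamma> l) \<le> Suc n" if l: "l \<in> plane_lines" for l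
  proof -
    define I where "I t = (if t = 0 then 0 else Suc (LEAST i. t \<le> u (Suc i)))" for t
    have I: "\<exists>i<n. I t = Suc i \<and> u i < t \<and> t \<le> u (Suc i)" if t: "0 < t" "t \<le> 1" for t
    proof -
      let ?i = "LEAST i. t \<le> u (Suc i)"
      have "n \<noteq> 0" using u by (cases "n = 0") simp_all
      then have ex: "t \<le> u (Suc (n - 1))" using u t by simp
      have 1: "t \<le> u (Suc ?i)" by (rule LeastI[where P = "\<lambda>i. t \<le> u (Suc i)", OF ex])
      have "?i \<le> n - 1" by (rule Least_le[where P = "\<lambda>i. t \<le> u (Suc i)", OF ex])
      then have 2: "?i < n" using \<open>n \<noteq> 0\<close> by simp
      have "u ?i < t"
      proof (cases ?i)
        case 0 then show ?thesis using u t by simp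
      next
        case (Suc k)
        then have "\<not> t \<le> u (Suc k)" by (intro not_less_Least) simp
        then show ?thesis using Suc by simp
      qed
      then show ?thesis using 1 2 t by (auto simp: I_def)
    qed
    have neq: "I s \<noteq> I t" if s: "s \<in> entry_points \<gamma> l" and t: "t \<in> entry_points \<gamma> l" and "s < t" for s t
    proof
      assume eq: "I s = I t"
      have t': "0 < t" "t \<le> 1" "0 \<le> s" "s \<le> 1"
        using s t \<open>s < t\<close> by (auto simp: entry_points_def)
      obtain i where i: "i < n" "I t = Suc i" "u i < t" "t \<le> u (Suc i)" using I t' by blast
      have "s \<noteq> 0" using eq i by (auto simp: I_def)
      then have "u i < s" using I[of s] t' eq i by auto
      obtain a b where ab: "\<forall>r\<in>{u i..u (Suc i)}. \<gamma> r = a + r *\<^sub>R b" using step i by blast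
      have "\<forall>\<epsilon>>0. \<exists>r \<in> {t - \<epsilon><..<t} \<inter> {0..1}. \<gamma> r \<notin> l"
        using t t' by (auto simp: entry_points_def)
      from this[rule_format, of "t - s"] obtain r where r: "s < r" "r < t" "\<gamma> r \<notin> l"
        using \<open>s < t\<close> by auto
      have "convex l"
      proof -
        obtain p d where "l = range (\<lambda>x::real. p + x *\<^sub>R d)" using l by (auto simp: plane_lines_def)
        also have "\<dots> = (+) p ` range (\<lambda>x::real. x *\<^sub>R d)" by auto
        finally show ?thesis
          by (simp add: convex_translation convex_linear_image bounded_linear_scaleR_left
              bounded_linear.linear)
      qed
      define w where "w = (r - s) / (t - s)"
      have w: "0 \<le> w" "w \<le> 1" using r by (auto simp: w_def)
      have "r - s = w * (t - s)" using \<open>s < t\<close> by (simp add: w_def)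
      then have wr: "r = (1 - w) * s + w * t" by (simp add: algebra_simps)
      have "\<gamma> r = (1 - w) *\<^sub>R \<gamma> s + w *\<^sub>R \<gamma> t"
      proof -
        have "\<gamma> r = a + r *\<^sub>R b" "\<gamma> s = a + s *\<^sub>R b" "\<gamma> t = a + t *\<^sub>R b"
          using ab r i \<open>u i < s\<close> \<open>s < t\<close> by auto
        then show ?thesis by (simp add: wr algebra_simps)
      qed
      also have "\<dots> \<in> l"
        using \<open>convex l\<close> w s t by (intro convexD) (auto simp: entry_points_def)
      finally show False using r by simp
    qed
    have inj: "inj_on I (entry_points \<gamma> l)"
      by (rule linorder_inj_onI) (use neq in auto)
    have sub: "I ` entry_points \<gamma> l \<subseteq> {..n}"
    proof (rule image_subsetI)
      fix t assume t: "t \<in> entry_points \<gamma> l"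
      show "I t \<in> {..n}"
        using I[of t] t by (cases "t = 0") (auto simp: entry_points_def I_def)
    qed
    then show ?thesis
      using inj finite_imageD[OF finite_subset[OF sub]] card_inj_on_le[OF inj sub] by simp
  qed
  then show ?thesis by blast
qed

end

theory Submission
  imports Defs
begin

text \<open>The functional calculus sends \<open>f\<close> to the limit of
  \<open>f(0) I + \<Sum>(f(\<lambda>\<^sub>n\<^sub>m) - f(0)) E\<^sub>n\<^sub>m\<close> over \<open>n \<le> N\<close> and \<open>m \<le> M\<close>. A segment ending at the
  origin has variation factor 1, so the numbers \<open>f(\<lambda>\<^sub>n\<^sub>m)\<close>, for fixed \<open>n\<close>, have total variation at
  most \<open>var \<sigma> f\<close>, and they tend to \<open>f(0)\<close> because functions in \<open>AC \<sigma>\<close> are continuous. Since the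
  partial sums of the projections on each ray are bounded by \<open>K\<close>, Abel summation yields
  convergence and the bound \<open>(1 + N K) \<parallel>f\<parallel>\<close>. The order of summation respects the order on each
  ray, so it only interleaves \<open>N\<close> convergent series.\<close>

section \<open>Bounded operators on a complex Banach space\<close>

interpretation complex_scale: vector_space "scaleC :: complex \<Rightarrow> 'a \<Rightarrow> 'a::complex_normed_vector"
  by (rule vector_space_scaleC)

lemma bounded_bilinear_scaleC:
  "bounded_bilinear (scaleC :: complex \<Rightarrow> 'a \<Rightarrow> 'a::complex_normed_vector)"
proof
  show "(r *\<^sub>R a) *\<^sub>C b = r *\<^sub>R (a *\<^sub>C b)" for r a and b :: 'a
    by (simp add: scaleR_eq_scaleC scaleC_scaleC scaleR_conv_of_real)
  show "a *\<^sub>C (r *\<^sub>R b) = r *\<^sub>R (a *\<^sub>C b)" for r a and b :: 'a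
    by (simp add: scaleR_eq_scaleC scaleC_scaleC mult.commute)
  show "\<exists>K. \<forall>a (b :: 'a). norm (a *\<^sub>C b) \<le> norm a * norm b * K"
    by (rule exI[of _ 1]) (simp add: norm_scaleC)
qed (simp_all add: scaleC_add_right scaleC_add_left)

lemmas tendsto_scaleC = bounded_bilinear.tendsto[OF bounded_bilinear_scaleC]

lemma scaleC_apply: "blinfun_apply (c *\<^sub>C A) x = c *\<^sub>C blinfun_apply A x"
  by transfer simp

lemma compose_scaleC_left: "(c *\<^sub>C A) o\<^sub>L B = c *\<^sub>C (A o\<^sub>L B)"
  by (rule blinfun_eqI) (simp add: scaleC_apply)

text \<open>Complex-linearity of \<open>A\<close> matters here: the operator type contains all
  bounded real-linear maps, and these need not commute with complex scalars.\<close>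

lemma compose_scaleC_right: "A \<in> bounded_ops \<Longrightarrow> A o\<^sub>L (c *\<^sub>C B) = c *\<^sub>C (A o\<^sub>L B)"
  by (rule blinfun_eqI) (simp add: scaleC_apply bounded_ops_def)

lemma id_in_bounded_ops: "id_blinfun \<in> bounded_ops"
  by (simp add: bounded_ops_def)

lemma add_in_bounded_ops: "A \<in> bounded_ops \<Longrightarrow> B \<in> bounded_ops \<Longrightarrow> A + B \<in> bounded_ops"
  by (simp add: bounded_ops_def blinfun.add_left scaleC_add_right)

lemma scaleC_in_bounded_ops: "A \<in> bounded_ops \<Longrightarrow> c *\<^sub>C A \<in> bounded_ops"
  by (simp add: bounded_ops_def scaleC_apply scaleC_scaleC mult.commute)

lemma sum_in_bounded_ops: "(\<And>i. i \<in> F \<Longrightarrow> A i \<in> bounded_ops) \<Longrightarrow> sum A F \<in> bounded_ops"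
  by (simp add: bounded_ops_def blinfun.sum_left complex_scale.scale_sum_right)

lemma lim_in_bounded_ops:
  assumes "\<And>k. A k \<in> bounded_ops" and lim: "A \<longlonglongrightarrow> L"
  shows "L \<in> bounded_ops"
  unfolding bounded_ops_def
proof (intro CollectI allI)
  fix c x
  have app: "(\<lambda>k. blinfun_apply (A k) y) \<longlonglongrightarrow> blinfun_apply L y" for y
    by (intro tendsto_intros lim)
  have "(\<lambda>k. blinfun_apply (A k) (c *\<^sub>C x)) \<longlonglongrightarrow> c *\<^sub>C blinfun_apply L x"
    using tendsto_scaleC[OF tendsto_const app[of x], of c] assms(1) by (simp add: bounded_ops_def)
  then show "blinfun_apply L (c *\<^sub>C x) = c *\<^sub>C blinfun_apply L x"
    using app[of "c *\<^sub>C x"] LIMSEQ_unique by blast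
qed

text \<open>Cross terms between distinct projections vanish. What remains at \<open>p\<close> has
  the coefficient a(d - c) + c(b - a) + (b - a)(d - c) = bd - ac, with \<open>b\<close> and
  \<open>d\<close> taken at \<open>p\<close>.\<close>

lemma compose_diagonal:
  fixes E :: "'i \<Rightarrow> 'a::complex_normed_vector \<Rightarrow>\<^sub>L 'a"
  assumes fin: "finite F"
    and proj: "\<And>p. p \<in> F \<Longrightarrow> is_projection (E p)"
    and disj: "\<And>p q. p \<in> F \<Longrightarrow> q \<in> F \<Longrightarrow> p \<noteq> q \<Longrightarrow> E p o\<^sub>L E q = 0"
  shows "(a *\<^sub>C id_blinfun + (\<Sum>p\<in>F. (b p - a) *\<^sub>C E p)) o\<^sub>L
           (c *\<^sub>C id_blinfun + (\<Sum>p\<in>F. (d p - c) *\<^sub>C E p)) =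
         (a * c) *\<^sub>C id_blinfun + (\<Sum>p\<in>F. (b p * d p - a * c) *\<^sub>C E p)"
proof -
  interpret comp: bounded_bilinear "(o\<^sub>L) :: ('a \<Rightarrow>\<^sub>L 'a) \<Rightarrow> ('a \<Rightarrow>\<^sub>L 'a) \<Rightarrow> _"
    by (rule bounded_bilinear_blinfun_compose)
  have E: "E p \<in> bounded_ops" "E p o\<^sub>L E p = E p" if "p \<in> F" for p
    using proj[OF that] by (auto simp: is_projection_def)
  let ?B = "\<Sum>p\<in>F. (b p - a) *\<^sub>C E p"
  have "?B o\<^sub>L (\<Sum>q\<in>F. (d q - c) *\<^sub>C E q) =
      (\<Sum>p\<in>F. \<Sum>q\<in>F. if q = p then ((b p - a) * (d p - c)) *\<^sub>C E p else 0)"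
    unfolding comp.sum_left comp.sum_right
    by (intro sum.cong refl)
      (auto simp: compose_scaleC_left compose_scaleC_right E disj scaleC_scaleC)
  also have "\<dots> = (\<Sum>p\<in>F. ((b p - a) * (d p - c)) *\<^sub>C E p)"
    by (intro sum.cong refl) (simp add: fin)
  finally have BD: "?B o\<^sub>L (\<Sum>q\<in>F. (d q - c) *\<^sub>C E q) = \<dots>" .
  have "?B \<in> bounded_ops"
    by (intro sum_in_bounded_ops scaleC_in_bounded_ops E)
  then have B: "?B o\<^sub>L (c *\<^sub>C id_blinfun) = c *\<^sub>C ?B"
    by (subst compose_scaleC_right) (auto intro!: blinfun_eqI)
  have I: "id_blinfun o\<^sub>L A = A" for A :: "'a \<Rightarrow>\<^sub>L 'a"
    by (auto intro!: blinfun_eqI)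
  show ?thesis
    by (simp add: comp.add_left comp.add_right BD B compose_scaleC_left I scaleC_add_right
        scaleC_scaleC complex_scale.scale_sum_right add.assoc flip: sum.distrib scaleC_add_left)
      (simp add: algebra_simps)
qed

section \<open>Norm limits of finite rank operators\<close>

text \<open>Induction on the spanning set. A new vector \<open>b\<close> outside the old span has
  positive distance from it, which controls the coefficient of \<open>b\<close>; the ball is then a
  closed part of a continuous image of a compact product. The radius stays arbitrary because the
  component in the old span may be longer than \<open>r\<close>.\<close>

lemma compact_span_cball:
  fixes B :: "'a::complex_normed_vector set"
  assumes "finite B"
  shows "compact (complex_scale.span B \<inter> cball 0 r)"
  using assms
proof (induction B arbitrary: r rule: finite_induct)
  case empty
  show ?case by (auto intro: finite_imp_compact)
next
  case (insert b B)
  let ?V = "complex_scale.span B"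
  show ?case
  proof (cases "b \<in> ?V")
    case True
    then show ?thesis using insert.IH by (simp add: complex_scale.span_redundant)
  next
    case False
    \<comment> \<open>A convergent sequence is bounded, so it stays in a ball that meets the span in
      a compact set, by induction.\<close>
    have "closed ?V"
      unfolding closed_sequential_limits
    proof (intro allI impI, elim conjE)
      fix x l assume x: "\<forall>n. x n \<in> ?V" "x \<longlonglongrightarrow> l"
      then obtain R where "\<forall>n. norm (x n) \<le> R"
        using Bseq_def convergentI convergent_imp_Bseq by metis
      then have "\<forall>n. x n \<in> ?V \<inter> cball 0 R" using x by simp
      then show "l \<in> ?V"
        using x(2) compact_imp_closed[OF insert.IH[of R]] closed_sequentially by blast
    qed
    then obtain d where d: "d > 0" "\<And>v. v \<in> ?V \<Longrightarrow> d \<le> dist b v"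
    proof -
      obtain d where "d > 0" "ball b d \<subseteq> - ?V"
        using \<open>closed ?V\<close> False unfolding closed_def open_contains_ball by blast
      then show ?thesis using that[of d] by (force simp: not_less[symmetric])
    qed
    \<comment> \<open>For nonzero \<open>c\<close>, dividing by \<open>c\<close> leaves
      \<open>b\<close> minus an element of \<open>?V\<close>, whose norm is at least
      \<open>d\<close>.\<close>
    have bound: "cmod c * d \<le> norm (c *\<^sub>C b + v)" if "v \<in> ?V" for c v
    proof (cases "c = 0")
      case False
      have "d \<le> norm (b - (- inverse c) *\<^sub>C v)"
        using d(2)[OF complex_scale.span_scale[OF that, of "- inverse c"]] by (simp add: dist_norm)
      then have "cmod c * d \<le> norm (c *\<^sub>C (b - (- inverse c) *\<^sub>C v))"
        by (simp add: norm_scaleC mult_left_mono)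
      also have "c *\<^sub>C (b - (- inverse c) *\<^sub>C v) = c *\<^sub>C b + v"
        using False by (simp add: scaleC_add_right scaleC_scaleC)
      finally show ?thesis .
    qed simp
    let ?g = "\<lambda>(c, v). c *\<^sub>C b + v"
    \<comment> \<open>If the vector has norm at most \<open>r\<close>, then \<open>bound\<close>
      gives the radius for \<open>c\<close>, and the triangle inequality gives the one for
      \<open>v\<close>.\<close>
    let ?S = "cball (0::complex) (r / d) \<times> (?V \<inter> cball 0 (r + r / d * norm b))"
    have "continuous_on ?S ?g"
      unfolding case_prod_unfold
      by (intro continuous_intros bounded_bilinear.continuous_on[OF bounded_bilinear_scaleC])
    then have "compact (?g ` ?S)"
      by (rule compact_continuous_image) (intro compact_Times compact_cball insert.IH)
    moreover have "complex_scale.span (insert b B) \<inter> cball 0 r = ?g ` ?S \<inter> cball 0 r"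
    proof (intro equalityI subsetI)
      fix x assume x: "x \<in> complex_scale.span (insert b B) \<inter> cball 0 r"
      then obtain c where c: "x - c *\<^sub>C b \<in> ?V"
        by (auto simp: complex_scale.span_insert)
      have "cmod c * d \<le> r" using bound[OF c, of c] x by simp
      then have 1: "cmod c \<le> r / d" using d(1) by (simp add: field_simps)
      have "norm (x - c *\<^sub>C b) \<le> norm x + cmod c * norm b"
        using norm_triangle_ineq4[of x "c *\<^sub>C b"] by (simp add: norm_scaleC)
      also have "\<dots> \<le> r + r / d * norm b"
        using x 1 by (intro add_mono mult_right_mono) auto
      finally show "x \<in> ?g ` ?S \<inter> cball 0 r"
        using x 1 c by (auto intro!: image_eqI[of _ _ "(c, x - c *\<^sub>C b)"])
    next
      fix x assume "x \<in> ?g ` ?S \<inter> cball 0 r"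
      then show "x \<in> complex_scale.span (insert b B) \<inter> cball 0 r"
        using complex_scale.span_mono[OF subset_insertI[of B b]]
        by (auto intro: complex_scale.span_add complex_scale.span_scale complex_scale.span_base)
    qed
    ultimately show ?thesis by (simp add: compact_Int_closed)
  qed
qed

lemma finite_rank_zero: "finite_rank 0"
  unfolding finite_rank_def by (rule exI[of _ "{}"]) auto

lemma finite_rank_add:
  assumes "finite_rank A" "finite_rank B"
  shows "finite_rank (A + B)"
proof -
  obtain F G where F: "finite F" "range (blinfun_apply A) \<subseteq> complex_scale.span F"
    and G: "finite G" "range (blinfun_apply B) \<subseteq> complex_scale.span G"
    using assms unfolding finite_rank_def by blast
  have "blinfun_apply (A + B) x \<in> complex_scale.span (F \<union> G)" for x
    using F(2) G(2) complex_scale.span_mono[of F "F \<union> G"] complex_scale.span_mono[of G "F \<union> G"]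
    by (auto simp: blinfun.add_left intro!: complex_scale.span_add)
  then show ?thesis unfolding finite_rank_def using F(1) G(1) by blast
qed

lemma finite_rank_scaleC: "finite_rank A \<Longrightarrow> finite_rank (c *\<^sub>C A)"
  unfolding finite_rank_def by (fastforce simp: scaleC_apply intro: complex_scale.span_scale)

lemma finite_rank_sum: "(\<And>i. i \<in> F \<Longrightarrow> finite_rank (A i)) \<Longrightarrow> finite_rank (sum A F)"
  by (induction F rule: infinite_finite_induct) (auto simp: finite_rank_zero finite_rank_add)

text \<open>Some \<open>A k\<close> is uniformly close to \<open>L\<close> on the unit ball and maps
  that ball into a compact set, so a finite net for this set is a coarser net for the image under
  \<open>L\<close>.\<close>

lemma compact_operator_limit:
  fixes A :: "nat \<Rightarrow> 'a::complex_banach \<Rightarrow>\<^sub>L 'a"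
  assumes ops: "\<And>k. A k \<in> bounded_ops" and rank: "\<And>k. finite_rank (A k)" and lim: "A \<longlonglongrightarrow> L"
  shows "compact_operator L"
  unfolding compact_operator_def
proof
  show "L \<in> bounded_ops" using lim_in_bounded_ops[OF ops lim] .
  let ?S = "blinfun_apply L ` cball 0 1"
  show "compact (closure ?S)"
    unfolding compact_eq_totally_bounded
  proof (intro conjI allI impI)
    show "complete (closure ?S)" by (simp add: complete_eq_closed)
    fix e :: real assume "e > 0"
    then obtain k where k: "norm (A k - L) < e / 3"
      using LIMSEQ_D[OF lim, of "e / 3"] by auto
    obtain B where B: "finite B" "range (blinfun_apply (A k)) \<subseteq> complex_scale.span B"
      using rank[of k] unfolding finite_rank_def by blast
    obtain C where C: "finite C"
      "complex_scale.span B \<inter> cball 0 (norm (A k)) \<subseteq> (\<Union>x\<in>C. ball x (e / 3))"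
      using compact_span_cball[OF B(1), of "norm (A k)"] \<open>e > 0\<close>
      unfolding compact_eq_totally_bounded by (meson divide_pos_pos zero_less_numeral)
    \<comment> \<open>Two errors of e/3 add up. Closed balls make the finite union closed, so it
      also contains the closure; the remaining e/3 leaves room for open balls.\<close>
    have "?S \<subseteq> (\<Union>x\<in>C. cball x (2 * e / 3))"
    proof (rule image_subsetI)
      fix v :: 'a assume "v \<in> cball 0 1"
      then have v: "norm v \<le> 1" by simp
      have le: "norm (blinfun_apply D v) \<le> norm D" for D :: "'a \<Rightarrow>\<^sub>L 'a"
        using norm_blinfun[of D v] mult_left_mono[OF v, of "norm D"] by simp
      obtain x where x: "x \<in> C" "dist x (blinfun_apply (A k) v) < e / 3"
      proof -
        have "blinfun_apply (A k) v \<in> complex_scale.span B \<inter> cball 0 (norm (A k))"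
          using B(2) le[of "A k"] by auto
        then show ?thesis using C(2) that by force
      qed
      have "dist (blinfun_apply (A k) v) (blinfun_apply L v) < e / 3"
        using le[of "A k - L"] k by (simp add: dist_norm blinfun.diff_left)
      then have "dist x (blinfun_apply L v) \<le> 2 * e / 3"
        using x(2) dist_triangle[of x "blinfun_apply L v" "blinfun_apply (A k) v"] by simp
      then show "blinfun_apply L v \<in> (\<Union>x\<in>C. cball x (2 * e / 3))" using x(1) by auto
    qed
    then have "closure ?S \<subseteq> (\<Union>x\<in>C. cball x (2 * e / 3))"
      by (rule closure_minimal) (simp add: C(1) closed_UN)
    also have "\<dots> \<subseteq> (\<Union>x\<in>C. ball x e)" using \<open>e > 0\<close> by (intro UN_mono) auto
    finally show "\<exists>C. finite C \<and> closure ?S \<subseteq> (\<Union>x\<in>C. ball x e)" using C(1) by blast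
  qed
qed

section \<open>Abel summation\<close>

lemma abel_summation:
  fixes x :: "nat \<Rightarrow> 'b::complex_normed_vector"
  shows "(\<Sum>i<n. a i *\<^sub>C x i) =
    a n *\<^sub>C (\<Sum>i<n. x i) - (\<Sum>i<n. (a (Suc i) - a i) *\<^sub>C (\<Sum>j<Suc i. x j))"
  by (induction n) (simp_all add: complex_scale.scale_left_diff_distrib scaleC_add_right)

text \<open>Summation by parts moves the differences onto the coefficients. The boundary term
  vanishes in the limit, and the rest is dominated by \<open>K\<close> times the variation of
  \<open>a\<close>; no absolute convergence of the original series is required.\<close>

lemma abel_summable:
  fixes x :: "nat \<Rightarrow> 'b::{complex_normed_vector,banach}"
  assumes a: "a \<longlonglongrightarrow> 0" and bv: "summable (\<lambda>i. cmod (a (Suc i) - a i))"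
    and K: "\<And>n. norm (\<Sum>i<n. x i) \<le> K"
  shows "summable (\<lambda>i. a i *\<^sub>C x i)"
    and "norm (\<Sum>i. a i *\<^sub>C x i) \<le> K * (\<Sum>i. cmod (a (Suc i) - a i))"
proof -
  let ?D = "\<lambda>i. (a (Suc i) - a i) *\<^sub>C (\<Sum>j<Suc i. x j)"
  have le: "norm (?D i) \<le> K * cmod (a (Suc i) - a i)" for i
    unfolding norm_scaleC by (subst mult.commute) (rule mult_right_mono[OF K norm_ge_zero])
  have sD: "summable (\<lambda>i. norm (?D i))"
    by (rule summable_comparison_test[OF _ summable_mult[OF bv, of K]]) (use le in auto)
  have "(\<lambda>n. a n *\<^sub>C (\<Sum>i<n. x i)) \<longlonglongrightarrow> 0"
  proof (rule Lim_null_comparison)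
    show "\<forall>\<^sub>F n in sequentially. norm (a n *\<^sub>C (\<Sum>i<n. x i)) \<le> cmod (a n) * K"
      by (intro always_eventually allI) (simp add: norm_scaleC mult_left_mono K)
    show "(\<lambda>n. cmod (a n) * K) \<longlonglongrightarrow> 0"
      using tendsto_mult_left_zero[OF tendsto_norm_zero[OF a], of K] .
  qed
  \<comment> \<open>Only the series \<open>?D\<close> survives in the limit; its minus sign
    disappears in the norm.\<close>
  from tendsto_diff[OF this summable_LIMSEQ[OF summable_norm_cancel[OF sD]]]
  have sums: "(\<lambda>i. a i *\<^sub>C x i) sums (- suminf ?D)"
    unfolding sums_def by (subst abel_summation) simp
  then show "summable (\<lambda>i. a i *\<^sub>C x i)" by (rule sums_summable)
  have "norm (suminf ?D) \<le> (\<Sum>i. norm (?D i))" by (rule summable_norm[OF sD])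
  also have "\<dots> \<le> (\<Sum>i. K * cmod (a (Suc i) - a i))"
    by (rule suminf_le[OF le sD summable_mult[OF bv]])
  also have "\<dots> = K * (\<Sum>i. cmod (a (Suc i) - a i))" by (rule suminf_mult[OF bv])
  finally show "norm (\<Sum>i. a i *\<^sub>C x i) \<le> K * (\<Sum>i. cmod (a (Suc i) - a i))"
    by (simp only: sums_unique[OF sums, symmetric] norm_minus_cancel)
qed

section \<open>Variation along a ray\<close>

lemma plane_line_convex: "l \<in> plane_lines \<Longrightarrow> convex l"
  unfolding plane_lines_def
proof clarify
  fix p d :: complex
  have "range (\<lambda>x::real. p + x *\<^sub>R d) = (+) p ` range (\<lambda>x::real. x *\<^sub>R d)" by auto
  then show "convex (range (\<lambda>x::real. p + x *\<^sub>R d))"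
    by (simp add: convex_translation convex_linear_image bounded_linear_scaleR_left
        bounded_linear.linear)
qed

text \<open>If the path were on a line at parameters s < t, then by convexity it would be on it
  throughout between them, so it could not enter again at t. Hence each line has at most one entry
  point.\<close>

lemma vf_segment:
  fixes a :: complex
  shows "vf (\<lambda>t. (1 - t) *\<^sub>R a) = 1"
proof -
  let ?\<gamma> = "\<lambda>t::real. (1 - t) *\<^sub>R a"
  have eq: "s = t" if l: "l \<in> plane_lines"
    and s: "s \<in> entry_points ?\<gamma> l" and t: "t \<in> entry_points ?\<gamma> l" and le: "s \<le> t" for l s t
  proof (rule ccontr)
    assume "s \<noteq> t"
    with le have "s < t" by simp
    with s have "0 \<le> s" "t \<noteq> 0" by (auto simp: entry_points_def)
    then have "\<forall>\<epsilon>>0. \<exists>r \<in> {t - \<epsilon><..<t} \<inter> {0..1}. ?\<gamma> r \<notin> l"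
      using t by (auto simp: entry_points_def)
    \<comment> \<open>A window reaching back exactly to \<open>s\<close> places the excursion off
      the line strictly between \<open>s\<close> and \<open>t\<close>.\<close>
    from this[rule_format, of "t - s"] obtain r where r: "s < r" "r < t" "?\<gamma> r \<notin> l"
      using \<open>s < t\<close> by auto
    define w where "w = (r - s) / (t - s)"
    have w: "0 \<le> w" "w \<le> 1" using r by (auto simp: w_def)
    have "r - s = w * (t - s)" using \<open>s < t\<close> by (simp add: w_def)
    then have "1 - r = (1 - w) * (1 - s) + w * (1 - t)" by (simp add: algebra_simps)
    then have "?\<gamma> r = (1 - w) *\<^sub>R ?\<gamma> s + w *\<^sub>R ?\<gamma> t" by (simp add: scaleR_add_left)
    also have "\<dots> \<in> l"
      using plane_line_convex[OF l] w s t by (intro convexD) (auto simp: entry_points_def)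
    finally show False using r by simp
  qed
  have eq': "s = t" if "l \<in> plane_lines" "s \<in> entry_points ?\<gamma> l" "t \<in> entry_points ?\<gamma> l" for l s t
    using eq[of l s t] eq[of l t s] that by (cases "s \<le> t") auto
  have le: "card (entry_points ?\<gamma> l) \<le> 1" if "l \<in> plane_lines" for l
    using eq'[OF that] by (metis (full_types) One_nat_def card_eq_0_iff card_le_Suc0_iff_eq le0)
  \<comment> \<open>The value 1 is attained on the horizontal line through the starting point, also
    when \<open>a\<close> is 0 and the path is constant.\<close>
  define l where "l = range (\<lambda>t::real. a + t *\<^sub>R 1)"
  have l: "l \<in> plane_lines" unfolding l_def plane_lines_def by (intro CollectI exI conjI) auto
  have "a \<in> l" unfolding l_def by (rule image_eqI[of _ _ 0]) auto
  then have "0 \<in> entry_points ?\<gamma> l" by (simp add: entry_points_def)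
  with eq'[OF l] have "entry_points ?\<gamma> l = {0}" by blast
  then have "card (entry_points ?\<gamma> l) = 1" by simp
  then have "1 \<in> {card (entry_points ?\<gamma> l) | l. l \<in> plane_lines}" using l by force
  moreover have sub: "{card (entry_points ?\<gamma> l) | l. l \<in> plane_lines} \<subseteq> {..1}" using le by blast
  ultimately show ?thesis
    unfolding vf_def by (intro Max_eqI finite_subset[OF sub]) blast+
qed

text \<open>All points lie on the segment from \<open>z 0\<close> to the origin and are met in their
  given order. That segment has variation factor 1, so the sum enters \<open>var\<close> with full
  weight.\<close>

lemma variation_along_ray:
  assumes z: "\<And>i. z i = complex_of_real (r i) * w" "\<And>i. z i \<in> \<sigma>"
    and r: "\<And>i. r i > 0" "\<And>i. r (Suc i) < r i"
  shows "(\<Sum>i<n. ennreal (cmod (f (z (Suc i)) - f (z i)))) \<le> var \<sigma> f"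
proof -
  let ?\<gamma> = "\<lambda>t::real. (1 - t) *\<^sub>R z 0"
  \<comment> \<open>The parameter solves (1 - t) r(0) = r(i), and it increases with \<open>i\<close>
    because \<open>r\<close> decreases.\<close>
  define t where "t i = 1 - r i / r 0" for i
  define s where "s = map t [0..<Suc n]"
  have dec: "r j < r i" if "i < j" for i j
    using lift_Suc_mono_less[of "\<lambda>i. - r i" i j] r(2) that by simp
  then have le: "r i \<le> r 0" for i by (cases i) (auto intro: less_imp_le)
  have \<gamma>: "?\<gamma> (t i) = z i" for i
    using r(1)[of 0] by (simp add: t_def z(1) scaleR_conv_of_real)
  have pl: "piecewise_linear_curve ?\<gamma>"
    unfolding piecewise_linear_curve_def
  proof (intro conjI exI)
    show "continuous_on {0..1} ?\<gamma>" by (intro continuous_intros)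
    have "?\<gamma> t = z 0 + t *\<^sub>R (- z 0)" for t by (simp add: algebra_simps)
    then show "\<forall>i<1. real i < real (Suc i) \<and>
        (\<exists>a b. \<forall>t\<in>{real i..real (Suc i)}. ?\<gamma> t = a + t *\<^sub>R b)"
      by (metis less_Suc_eq of_nat_less_iff)
  qed auto
  have "sorted_wrt (<) s"
    unfolding s_def sorted_wrt_map
    by (rule sorted_wrt_mono_rel[OF _ sorted_wrt_upt])
      (use dec r in \<open>simp add: t_def divide_strict_right_mono\<close>)
  moreover have "t i \<in> {0..1}" for i
    using r(1)[of i] r(1)[of 0] le[of i] by (simp add: t_def)
  ultimately have "s \<in> {s. sorted_wrt (<) s \<and> (\<forall>t \<in> set s. t \<in> {0..1} \<and> ?\<gamma> t \<in> \<sigma>)}"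
    using z(2) \<gamma> by (auto simp: s_def)
  then have "(\<Sum>i<length s - 1. ennreal (cmod (f (?\<gamma> (s ! Suc i)) - f (?\<gamma> (s ! i))))) \<le> cvar \<sigma> f ?\<gamma>"
    unfolding cvar_def by (rule SUP_upper)
  also have "(\<Sum>i<length s - 1. ennreal (cmod (f (?\<gamma> (s ! Suc i)) - f (?\<gamma> (s ! i))))) =
      (\<Sum>i<n. ennreal (cmod (f (z (Suc i)) - f (z i))))"
    by (intro sum.cong) (auto simp: s_def \<gamma> simp del: upt_Suc)
  also have "cvar \<sigma> f ?\<gamma> = cvar \<sigma> f ?\<gamma> * ennreal (1 / real (vf ?\<gamma>))"
    by (simp add: vf_segment)
  also have "\<dots> \<le> var \<sigma> f"
    unfolding var_def by (rule SUP_upper) (simp add: pl)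
  finally show ?thesis .
qed

lemma BV_norm_bounds:
  assumes "BV_norm \<sigma> f < ennreal \<delta>"
  shows "z \<in> \<sigma> \<Longrightarrow> cmod (f z) < \<delta>" and "var \<sigma> f < ennreal \<delta>"
proof -
  have le: "(SUP z \<in> \<sigma>. ennreal (cmod (f z))) \<le> BV_norm \<sigma> f" "var \<sigma> f \<le> BV_norm \<sigma> f"
    by (simp_all add: BV_norm_def)
  then show "var \<sigma> f < ennreal \<delta>" using assms by simp
  assume "z \<in> \<sigma>"
  then have "ennreal (cmod (f z)) \<le> BV_norm \<sigma> f"
    using le(1) by (meson SUP_upper order_trans)
  then have "ennreal (cmod (f z)) < ennreal \<delta>" using assms by (rule le_less_trans)
  then show "cmod (f z) < \<delta>" by (simp add: ennreal_less_iff)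
qed

text \<open>The BV norm dominates the supremum norm, so \<open>f\<close> is a uniform limit of
  polynomials on \<open>\<sigma>\<close>.\<close>

lemma AC_continuous_on:
  assumes f: "f \<in> AC \<sigma>"
  shows "continuous_on \<sigma> f"
proof -
  have "\<exists>p. p \<in> polys \<sigma> \<and> BV_norm \<sigma> (\<lambda>z. f z - p z) < ennreal (inverse (Suc k))" for k :: nat
  proof -
    have "inverse (real (Suc k)) > 0" by simp
    then show ?thesis using f unfolding AC_def by blast
  qed
  then obtain p where p: "\<And>k. p k \<in> polys \<sigma>"
    "\<And>k. BV_norm \<sigma> (\<lambda>z. f z - p k z) < ennreal (inverse (Suc k))" by metis
  have "uniform_limit \<sigma> p f sequentially"
  proof (rule uniform_limitI)
    fix e :: real assume "e > 0"
    then have "\<forall>\<^sub>F k in sequentially. inverse (real (Suc k)) < e"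
      by (rule order_tendstoD(2)[OF LIMSEQ_inverse_real_of_nat])
    then show "\<forall>\<^sub>F k in sequentially. \<forall>z\<in>\<sigma>. dist (p k z) (f z) < e"
      by eventually_elim
        (use BV_norm_bounds(1)[OF p(2)] in \<open>auto simp: dist_norm norm_minus_commute intro: less_trans\<close>)
  qed
  moreover have "continuous_on \<sigma> (p k)" for k
  proof -
    obtain d :: nat and c where "p k = restr \<sigma> (\<lambda>z. \<Sum>i\<le>d. \<Sum>j\<le>d. c i j * z ^ i * cnj z ^ j)"
      using p(1)[of k] by (auto simp: polys_def)
    moreover have "continuous_on \<sigma> (\<lambda>z. \<Sum>i\<le>d. \<Sum>j\<le>d. c i j * z ^ i * cnj z ^ j)"
      by (intro continuous_intros)
    ultimately show ?thesis by (simp add: restr_def cong: continuous_on_cong)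
  qed
  ultimately show ?thesis by (intro uniform_limit_theorem[where f = p and F = sequentially]) auto
qed

section \<open>Enumerations\<close>

text \<open>Rank each element by its number of predecessors. Ranks strictly increase along
  \<open>R\<close>, and they form an infinite, downward closed set of naturals, hence all of them;
  the inverse of the rank is the enumeration.\<close>

lemma ex_increasing_enumeration:
  assumes inf: "infinite I" and fin: "\<And>p. p \<in> I \<Longrightarrow> finite {q \<in> I. R q p}"
    and irrefl: "\<And>p. \<not> R p p"
    and trans: "\<And>p q r. R p q \<Longrightarrow> R q r \<Longrightarrow> R p r"
    and total: "\<And>p q. p \<in> I \<Longrightarrow> q \<in> I \<Longrightarrow> p \<noteq> q \<Longrightarrow> R p q \<or> R q p"
  obtains e :: "nat \<Rightarrow> 'i" where "bij_betw e UNIV I" "\<And>i j. i < j \<Longrightarrow> R (e i) (e j)"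
proof -
  define rk where "rk p = card {q \<in> I. R q p}" for p
  have mono: "rk p < rk q" if "p \<in> I" "q \<in> I" "R p q" for p q
    unfolding rk_def using that irrefl trans by (intro psubset_card_mono fin) blast+
  have inj: "inj_on rk I"
    by (rule inj_onI) (metis mono total less_irrefl)
  have down: "{..<rk p} \<subseteq> rk ` I" if "p \<in> I" for p
  proof -
    \<comment> \<open>The predecessors of \<open>p\<close> are mapped injectively into a set of the
      same finite cardinality, hence onto it.\<close>
    have "rk ` {q \<in> I. R q p} = {..<rk p}"
    proof (rule card_subset_eq)
      show "rk ` {q \<in> I. R q p} \<subseteq> {..<rk p}" using mono that by auto
      have "card (rk ` {q \<in> I. R q p}) = card {q \<in> I. R q p}"
        by (rule card_image[OF inj_on_subset[OF inj]]) auto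
      then show "card (rk ` {q \<in> I. R q p}) = card {..<rk p}" by (simp add: rk_def)
    qed simp
    then show ?thesis by blast
  qed
  have "k \<in> rk ` I" for k
  proof -
    have "infinite (rk ` I)" using inf inj by (simp add: finite_image_iff)
    then obtain p where "p \<in> I" "k < rk p" unfolding infinite_nat_iff_unbounded by auto
    then show ?thesis using down by auto
  qed
  then have bij: "bij_betw rk I UNIV" using inj by (auto simp: bij_betw_def)
  let ?e = "inv_into I rk"
  have e: "?e i \<in> I" "rk (?e i) = i" for i
    using bij by (auto simp: bij_betw_def inv_into_into f_inv_into_f)
  show ?thesis
  proof
    show "bij_betw ?e UNIV I" by (rule bij_betw_inv_into[OF bij])
    fix i j :: nat assume "i < j"
    then show "R (?e i) (?e j)" using e[of i] e[of j] mono total by (metis less_asym' less_irrefl)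
  qed
qed

text \<open>Every partial sum along \<open>e\<close> consists of an initial segment of each of the \<open>N\<close> series.\<close>

lemma sums_interleaved:
  fixes x :: "nat \<Rightarrow> nat \<Rightarrow> 'b::real_normed_vector"
  assumes bij: "bij_betw e UNIV ({1..N} \<times> {1..})"
    and order: "\<And>i j n m m'. \<lbrakk>e i = (n, m); e j = (n, m'); m < m'\<rbrakk> \<Longrightarrow> i < (j::nat)"
    and s: "\<And>n. n \<in> {1..N} \<Longrightarrow> (\<lambda>i. x n (Suc i)) sums s n"
  shows "(\<lambda>k. x (fst (e k)) (snd (e k))) sums (\<Sum>n=1..N. s n)"
proof -
  define D where "D n k = {m. (n, m) \<in> e ` {..<k}}" for n k
  have eI: "e i \<in> {1..N} \<times> {1..}" for i using bij by (auto simp: bij_betw_def)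
  have sur: "\<exists>i. e i = p" if "p \<in> {1..N} \<times> {1..}" for p
    using bij that by (metis bij_betw_imp_surj_on imageE)
  have eD: "n \<in> {1..N} \<and> m \<ge> 1" if "(n, m) \<in> e ` S" for n m S
    using that eI by (metis SigmaD1 SigmaD2 atLeast_iff imageE)
  have finD: "finite (D n k)" for n k
  proof -
    have "D n k \<subseteq> snd ` e ` {..<k}" unfolding D_def by (metis image_eqI mem_Collect_eq snd_conv subsetI)
    then show ?thesis by (rule finite_subset) simp
  qed
  \<comment> \<open>The largest index of ray \<open>n\<close> met so far is preceded in
    \<open>e\<close> by all smaller indices of that ray, so there are no gaps.\<close>
  have D: "D n k = {1..card (D n k)}" if n: "n \<in> {1..N}" for n k
  proof -
    have "\<exists>M. D n k = {1..M}"
    proof (cases "D n k = {}")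
      case False
      have "D n k = {1..Max (D n k)}"
      proof (intro equalityI subsetI)
        fix m assume "m \<in> D n k"
        moreover from this have "m \<ge> 1" using eD unfolding D_def by blast
        ultimately show "m \<in> {1..Max (D n k)}" using finD by simp
      next
        fix m assume m: "m \<in> {1..Max (D n k)}"
        have "Max (D n k) \<in> D n k" using Max_in[OF finD False] .
        then obtain j where j: "j < k" "e j = (n, Max (D n k))"
          unfolding D_def mem_Collect_eq by (metis imageE lessThan_iff)
        obtain i where i: "e i = (n, m)" using sur[of "(n, m)"] n m by auto
        have "i < k"
        proof (cases "m = Max (D n k)")
          case True
          then have "i = j" using i j bij by (metis bij_betw_def inj_eq)
          then show ?thesis using j by simp
        next
          case False
          then show ?thesis using order[OF i j(2)] m j(1) by simp
        qed
        then show "m \<in> D n k" using i by (auto simp: D_def intro: image_eqI[of _ e i])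
      qed
      then show ?thesis ..
    qed (auto intro: exI[of _ 0])
    then show ?thesis by (metis card_atLeastAtMost diff_Suc_1)
  qed
  \<comment> \<open>Once \<open>(n, Suc Z)\<close> has been met, the absence of gaps forces more
    than \<open>Z\<close> indices of ray \<open>n\<close> to have been met.\<close>
  have lim: "filterlim (\<lambda>k. card (D n k)) at_top sequentially" if n: "n \<in> {1..N}" for n
    unfolding filterlim_at_top
  proof
    fix Z :: nat
    obtain j where j: "e j = (n, Suc Z)" using sur[of "(n, Suc Z)"] n by auto
    show "\<forall>\<^sub>F k in sequentially. Z \<le> card (D n k)"
      using eventually_gt_at_top[of j]
    proof eventually_elim
      case (elim k)
      then have "Suc Z \<in> D n k" using j by (auto simp: D_def intro: image_eqI[of _ e j])
      then have "Suc Z \<in> {1..card (D n k)}" by (simp only: D[OF n, symmetric])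
      then show ?case by simp
    qed
  qed
  have part: "(\<Sum>i<k. x (fst (e i)) (snd (e i))) = (\<Sum>n=1..N. \<Sum>i<card (D n k). x n (Suc i))" for k
  proof -
    have inj: "inj_on e {..<k}" using bij by (auto simp: bij_betw_def intro: inj_on_subset)
    have "(n, m) \<in> e ` {..<k} \<longleftrightarrow> (n, m) \<in> Sigma {1..N} (\<lambda>n. D n k)" for n m
      unfolding D_def mem_Sigma_iff mem_Collect_eq using eD[of n m "{..<k}"] by argo
    then have "e ` {..<k} = Sigma {1..N} (\<lambda>n. D n k)" by (intro set_eqI) (simp only: split_paired_all)
    then have "(\<Sum>i<k. x (fst (e i)) (snd (e i))) = (\<Sum>(n,m)\<in>Sigma {1..N} (\<lambda>n. D n k). x n m)"
      using sum.reindex[OF inj, of "\<lambda>p. x (fst p) (snd p)"] by (simp add: case_prod_unfold)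
    also have "\<dots> = (\<Sum>n=1..N. \<Sum>m\<in>D n k. x n m)"
      by (rule sum.Sigma[symmetric]) (auto simp: finD)
    also have "\<dots> = (\<Sum>n=1..N. \<Sum>i<card (D n k). x n (Suc i))"
    proof (rule sum.cong[OF refl])
      fix n assume "n \<in> {1..N}"
      then have "sum (x n) (D n k) = sum (x n) {1..card (D n k)}" using D by metis
      then show "sum (x n) (D n k) = (\<Sum>i<card (D n k). x n (Suc i))"
        by (simp add: sum.atLeast1_atMost_eq)
    qed
    finally show ?thesis .
  qed
  have "(\<lambda>k. \<Sum>n=1..N. \<Sum>i<card (D n k). x n (Suc i)) \<longlonglongrightarrow> (\<Sum>n=1..N. s n)"
    by (intro tendsto_sum filterlim_compose[OF _ lim] s[unfolded sums_def])
  then show ?thesis unfolding sums_def part .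
qed

section \<open>The functional calculus of a system of projections on rays\<close>

locale ray_projections =
  fixes N :: nat
    and \<theta> :: "nat \<Rightarrow> real"
    and lam :: "nat \<Rightarrow> nat \<Rightarrow> complex"
    and E :: "nat \<Rightarrow> nat \<Rightarrow> 'a::complex_banach \<Rightarrow>\<^sub>L 'a"
    and \<sigma> :: "complex set" and K :: real
  assumes N: "N \<ge> 1" and angles: "inj_on \<theta> {1..N}"
    and proj: "\<lbrakk>n \<in> {1..N}; m \<ge> 1\<rbrakk> \<Longrightarrow> is_projection (E n m)"
    and ray: "\<lbrakk>n \<in> {1..N}; m \<ge> 1\<rbrakk> \<Longrightarrow> lam n m \<in> ray (\<theta> n)"
    and decreasing: "\<lbrakk>n \<in> {1..N}; m \<ge> 1\<rbrakk> \<Longrightarrow> cmod (lam n (Suc m)) < cmod (lam n m)"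
    and null: "n \<in> {1..N} \<Longrightarrow> lam n \<longlonglongrightarrow> 0"
    and disj: "\<lbrakk>p \<in> {1..N} \<times> {1..}; q \<in> {1..N} \<times> {1..}; p \<noteq> q\<rbrakk> \<Longrightarrow>
      disjoint_ops (E (fst p) (snd p)) (E (fst q) (snd q))"
    and rank: "\<lbrakk>n \<in> {1..N}; m \<ge> 1\<rbrakk> \<Longrightarrow> finite_rank (E n m)"
    and bound: "\<lbrakk>n \<in> {1..N}; M \<ge> 1\<rbrakk> \<Longrightarrow> norm (\<Sum>m=1..M. E n m) \<le> K"
    and \<sigma>: "\<sigma> = {0} \<union> {lam n m | n m. n \<in> {1..N} \<and> m \<ge> 1}"
begin

section \<open>Moduli and directions of the eigenvalues, and their order\<close>

lemma zero_in: "0 \<in> \<sigma>" and lam_in: "n \<in> {1..N} \<Longrightarrow> m \<ge> 1 \<Longrightarrow> lam n m \<in> \<sigma>"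
  using \<sigma> by auto

lemma E_bounded: "n \<in> {1..N} \<Longrightarrow> m \<ge> 1 \<Longrightarrow> E n m \<in> bounded_ops"
  using proj by (simp add: is_projection_def)

lemma cmod_lam_less: "\<lbrakk>n \<in> {1..N}; 1 \<le> m; m < m'\<rbrakk> \<Longrightarrow> cmod (lam n m') < cmod (lam n m)"
  using lift_Suc_mono_less[of "\<lambda>i. - cmod (lam n (Suc i))" "m - 1" "m' - 1"] decreasing[of n] by simp

lemma cmod_lam_pos: "n \<in> {1..N} \<Longrightarrow> m \<ge> 1 \<Longrightarrow> 0 < cmod (lam n m)"
  using decreasing[of n m] norm_ge_zero[of "lam n (Suc m)"] by linarith

lemma lam_polar:
  assumes "n \<in> {1..N}" "m \<ge> 1"
  shows "lam n m = complex_of_real (cmod (lam n m)) * exp (\<i> * complex_of_real (\<theta> n))"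
  using ray[OF assms] by (auto simp: ray_def norm_mult)

lemma K_nonneg: "K \<ge> 0"
  using order_trans[OF norm_ge_zero bound[of 1 1]] N by simp

lemma partial_sums_bounded: "n \<in> {1..N} \<Longrightarrow> norm (\<Sum>i<M. E n (Suc i)) \<le> K"
  using bound[of n M] K_nonneg by (cases "M = 0") (simp_all add: sum.atLeast1_atMost_eq)

text \<open>Indices on one ray are separated by their moduli, those on different rays by modulus or
  else by angle, so the order is total. Predecessors are finite in number because each of the
  \<open>N\<close> sequences of moduli eventually drops below the given positive one.\<close>

lemma ex_ordered_enumeration:
  obtains e where "ordered_enumeration N lam \<theta> e"
proof -
  let ?I = "{1..N} \<times> {1::nat..}" and ?R = "\<lambda>p q. comes_after lam \<theta> q p"
  have total: "?R p q \<or> ?R q p" if pq: "p \<in> ?I" "q \<in> ?I" "p \<noteq> q" for p q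
  proof -
    obtain n m s t where [simp]: "p = (n, m)" "q = (s, t)" by (cases p, cases q) auto
    show ?thesis
    proof (cases "n = s")
      case True
      with pq consider "m < t" | "t < m" by fastforce
      then show ?thesis
        using pq True cmod_lam_less[of n m t] cmod_lam_less[of n t m]
        by cases (simp_all add: comes_after_def)
    next
      case False
      then have "\<theta> n \<noteq> \<theta> s" using inj_onD[OF angles, of n s] pq by auto
      then show ?thesis by (auto simp: comes_after_def)
    qed
  qed
  have fin: "finite {q \<in> ?I. ?R q p}" if p: "p \<in> ?I" for p
  proof -
    obtain n m where [simp]: "p = (n, m)" by (cases p)
    have pos: "0 < cmod (lam n m)" using p cmod_lam_pos by simp
    have "\<exists>T. \<forall>t\<ge>T. cmod (lam s t) < cmod (lam n m)" if "s \<in> {1..N}" for s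
      using LIMSEQ_D[OF null[OF that] pos] by simp
    then obtain T where T: "\<And>s t. s \<in> {1..N} \<Longrightarrow> t \<ge> T s \<Longrightarrow> cmod (lam s t) < cmod (lam n m)"
      by metis
    have "{q \<in> ?I. ?R q p} \<subseteq> Sigma {1..N} (\<lambda>s. {..<T s})"
      using T by (fastforce simp: comes_after_def not_le[symmetric])
    then show ?thesis by (rule finite_subset) auto
  qed
  have inf: "infinite ?I"
    using N finite_cartesian_productD2[of "{1..N}" "{1::nat..}"] infinite_Ici by auto
  have irrefl: "\<not> ?R p p" and trans: "?R p q \<Longrightarrow> ?R q r \<Longrightarrow> ?R p r" for p q r
    by (auto simp: comes_after_def)
  show ?thesis
  proof (rule ex_increasing_enumeration[of ?I ?R, OF inf fin irrefl trans total])
    fix e :: "nat \<Rightarrow> nat \<times> nat" assume "bij_betw e UNIV ?I" "\<And>i j. i < j \<Longrightarrow> ?R (e i) (e j)"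
    then show thesis by (intro that[of e]) (simp add: ordered_enumeration_def)
  qed
qed

text \<open>On a single ray a larger index has a smaller modulus and so comes later; this is the
  order condition of \<open>sums_interleaved\<close>.\<close>

lemma ordered_enumeration_sums:
  fixes x :: "nat \<Rightarrow> nat \<Rightarrow> 'b::real_normed_vector"
  assumes e: "ordered_enumeration N lam \<theta> e"
    and s: "\<And>n. n \<in> {1..N} \<Longrightarrow> (\<lambda>i. x n (Suc i)) sums s n"
  shows "(\<lambda>k. x (fst (e k)) (snd (e k))) sums (\<Sum>n=1..N. s n)"
proof (rule sums_interleaved[OF _ _ s])
  show bij: "bij_betw e UNIV ({1..N} \<times> {1..})" using e by (simp add: ordered_enumeration_def)
  fix i j n m m' assume ij: "e i = (n, m)" "e j = (n, m')" "m < m'"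
  have "e i \<in> {1..N} \<times> {1..}" using bij by (auto simp: bij_betw_def)
  then have less: "cmod (lam n m') < cmod (lam n m)" using cmod_lam_less ij by simp
  show "i < j"
  proof (rule ccontr)
    assume "\<not> i < j"
    then have "j < i" using ij by (cases i j rule: linorder_cases) auto
    then have "comes_after lam \<theta> (e i) (e j)" using e by (simp add: ordered_enumeration_def)
    then show False using ij less by (simp add: comes_after_def)
  qed
qed

section \<open>The truncated calculus and its algebraic identities\<close>

definition calculus_part :: "nat \<Rightarrow> (complex \<Rightarrow> complex) \<Rightarrow> 'a \<Rightarrow>\<^sub>L 'a" where
  "calculus_part M f = f 0 *\<^sub>C id_blinfun +
     (\<Sum>p\<in>{1..N} \<times> {1..M}. (f (lam (fst p) (snd p)) - f 0) *\<^sub>C E (fst p) (snd p))"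

definition calculus :: "(complex \<Rightarrow> complex) \<Rightarrow> 'a \<Rightarrow>\<^sub>L 'a" where
  "calculus f = lim (\<lambda>M. calculus_part M f)"

lemma calculus_eqI: "(\<lambda>M. calculus_part M f) \<longlonglongrightarrow> L \<Longrightarrow> calculus f = L"
  unfolding calculus_def by (rule limI)

lemma calculus_part_bounded: "calculus_part M f \<in> bounded_ops"
  unfolding calculus_part_def
  by (intro add_in_bounded_ops scaleC_in_bounded_ops id_in_bounded_ops sum_in_bounded_ops)
    (auto intro!: E_bounded)

lemma calculus_part_add:
  "calculus_part M (\<lambda>z. f z + g z) = calculus_part M f + calculus_part M g"
  by (simp add: calculus_part_def scaleC_add_left complex_scale.scale_left_diff_distrib
      sum.distrib sum_subtractf)

lemma calculus_part_scale: "calculus_part M (\<lambda>z. c * f z) = c *\<^sub>C calculus_part M f"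
  by (simp add: calculus_part_def scaleC_add_right complex_scale.scale_sum_right scaleC_scaleC
      right_diff_distrib)

lemma calculus_part_diff:
  "calculus_part M (\<lambda>z. f z - g z) = calculus_part M f - calculus_part M g"
  using calculus_part_add[of M "\<lambda>z. f z - g z" g] by simp

text \<open>The truncation acts as \<open>f (lam n m)\<close> on the range of each
  \<open>E n m\<close> with m \<le> M and as \<open>f 0\<close> on their common kernel. It is
  therefore exactly multiplicative before any limit is taken.\<close>

lemma calculus_part_mult:
  "calculus_part M (\<lambda>z. f z * g z) = calculus_part M f o\<^sub>L calculus_part M g"
  unfolding calculus_part_def
proof (rule compose_diagonal[symmetric])
  fix p q assume pq: "p \<in> {1..N} \<times> {1..M}" "q \<in> {1..N} \<times> {1..M}"
  then show "is_projection (E (fst p) (snd p))" by (auto intro: proj)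
  assume "p \<noteq> q"
  then show "E (fst p) (snd p) o\<^sub>L E (fst q) (snd q) = 0"
    using disj[of p q] pq by (auto simp: disjoint_ops_def)
qed simp

lemma calculus_part_one: "calculus_part M (restr \<sigma> (\<lambda>z. 1)) = id_blinfun"
proof -
  have "(restr \<sigma> (\<lambda>z. 1) (lam (fst p) (snd p)) - restr \<sigma> (\<lambda>z. 1) 0) *\<^sub>C E (fst p) (snd p) = 0"
    if "p \<in> {1..N} \<times> {1..M}" for p
    using that lam_in zero_in by (auto simp: restr_def)
  then have "(\<Sum>p\<in>{1..N} \<times> {1..M}. (restr \<sigma> (\<lambda>z. 1) (lam (fst p) (snd p)) -
      restr \<sigma> (\<lambda>z. 1) 0) *\<^sub>C E (fst p) (snd p)) = 0"
    by (rule sum.neutral[OF ballI])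
  then show ?thesis by (simp add: calculus_part_def restr_def zero_in)
qed

section \<open>Convergence of the truncations and the functional calculus\<close>

lemma calculus_part_lim:
  assumes "\<And>n. n \<in> {1..N} \<Longrightarrow> (\<lambda>i. (f (lam n (Suc i)) - f 0) *\<^sub>C E n (Suc i)) sums s n"
  shows "(\<lambda>M. calculus_part M f) \<longlonglongrightarrow> f 0 *\<^sub>C id_blinfun + (\<Sum>n=1..N. s n)"
proof -
  have "calculus_part M f = f 0 *\<^sub>C id_blinfun +
      (\<Sum>n=1..N. \<Sum>i<M. (f (lam n (Suc i)) - f 0) *\<^sub>C E n (Suc i))" for M
    unfolding calculus_part_def sum.cartesian_product' by (simp add: sum.atLeast1_atMost_eq)
  moreover have "(\<lambda>M. f 0 *\<^sub>C id_blinfun +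
      (\<Sum>n=1..N. \<Sum>i<M. (f (lam n (Suc i)) - f 0) *\<^sub>C E n (Suc i)))
      \<longlonglongrightarrow> f 0 *\<^sub>C id_blinfun + (\<Sum>n=1..N. s n)"
    by (intro tendsto_intros assms[unfolded sums_def])
  ultimately show ?thesis by simp
qed

text \<open>The multiple of the identity contributes \<delta> to the norm and each of the
  \<open>N\<close> rays at most K\<delta>, by Abel summation. Assuming continuity and bounds instead
  of membership in \<open>AC\<close> lets the estimate apply directly to a difference of two
  functions.\<close>

lemma calculus_part_converges:
  assumes cont: "continuous_on \<sigma> f" and f0: "cmod (f 0) \<le> \<delta>" and var: "var \<sigma> f \<le> ennreal \<delta>"
  obtains L where "(\<lambda>M. calculus_part M f) \<longlonglongrightarrow> L" "norm L \<le> (1 + N * K) * \<delta>"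
proof -
  have "\<delta> \<ge> 0" using f0 norm_ge_zero order_trans by blast
  define a where "a n i = f (lam n (Suc i)) - f 0" for n i
  define s where "s n = (\<Sum>i. a n i *\<^sub>C E n (Suc i))" for n
  have s: "(\<lambda>i. a n i *\<^sub>C E n (Suc i)) sums s n \<and> norm (s n) \<le> K * \<delta>" if n: "n \<in> {1..N}" for n
  proof -
    have "(\<lambda>i. f (lam n (Suc i))) \<longlonglongrightarrow> f 0"
      using continuous_on_tendsto_compose[OF cont LIMSEQ_Suc[OF null[OF n]] zero_in] lam_in n
      by simp
    then have null': "a n \<longlonglongrightarrow> 0" unfolding a_def by (simp add: LIM_zero)
    have "(\<Sum>i<M. ennreal (cmod (a n (Suc i) - a n i))) \<le> ennreal \<delta>" for M
      using variation_along_ray[where z = "\<lambda>i. lam n (Suc i)" and r = "\<lambda>i. cmod (lam n (Suc i))"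
          and w = "exp (\<i> * complex_of_real (\<theta> n))" and \<sigma> = \<sigma> and n = M and f = f] var lam_polar[OF n] lam_in[OF n]
        cmod_lam_pos[OF n] decreasing[OF n]
      by (simp add: a_def)
    then have le: "(\<Sum>i<M. cmod (a n (Suc i) - a n i)) \<le> \<delta>" for M
      using \<open>\<delta> \<ge> 0\<close> by (simp add: sum_ennreal)
    then have bv: "summable (\<lambda>i. cmod (a n (Suc i) - a n i))"
      by (intro summableI_nonneg_bounded) auto
    note abel = abel_summable[OF null' bv partial_sums_bounded[OF n]]
    have "norm (s n) \<le> K * (\<Sum>i. cmod (a n (Suc i) - a n i))"
      unfolding s_def by (rule abel(2))
    also have "\<dots> \<le> K * \<delta>"
      by (intro mult_left_mono suminf_le_const bv le K_nonneg)
    finally show ?thesis using summable_sums[OF abel(1)] by (simp add: s_def)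
  qed
  show ?thesis
  proof
    show "(\<lambda>M. calculus_part M f) \<longlonglongrightarrow> f 0 *\<^sub>C id_blinfun + (\<Sum>n=1..N. s n)"
      by (rule calculus_part_lim) (use s in \<open>auto simp: a_def\<close>)
    \<comment> \<open>An inequality is used because the norm of the identity is 0 on the zero
      space.\<close>
    have "norm (id_blinfun :: 'a \<Rightarrow>\<^sub>L 'a) \<le> 1" by (rule norm_blinfun_id_le)
    then have "norm (f 0 *\<^sub>C (id_blinfun :: 'a \<Rightarrow>\<^sub>L 'a)) \<le> \<delta> * 1"
      unfolding norm_scaleC using f0 \<open>\<delta> \<ge> 0\<close> by (intro mult_mono) auto
    moreover have "norm (\<Sum>n=1..N. s n) \<le> (\<Sum>n=1..N. K * \<delta>)"
      using s by (intro sum_norm_le) auto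
    ultimately have "norm (f 0 *\<^sub>C (id_blinfun :: 'a \<Rightarrow>\<^sub>L 'a) + (\<Sum>n=1..N. s n)) \<le> \<delta> + N * (K * \<delta>)"
      by (intro norm_triangle_le) simp
    then show "norm (f 0 *\<^sub>C (id_blinfun :: 'a \<Rightarrow>\<^sub>L 'a) + (\<Sum>n=1..N. s n)) \<le> (1 + N * K) * \<delta>"
      by (simp add: algebra_simps)
  qed
qed

lemma calculus_part_AC:
  assumes f: "f \<in> AC \<sigma>"
  shows "(\<lambda>M. calculus_part M f) \<longlonglongrightarrow> calculus f"
proof -
  have "BV_norm \<sigma> f < \<infinity>" using f by (simp add: AC_def BV_def)
  then obtain \<delta> where "BV_norm \<sigma> f < ennreal \<delta>"
    by (metis ennreal_cases ennreal_less_iff gt_ex infinity_ennreal_def not_less_iff_gr_or_eq)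
  from BV_norm_bounds[OF this] have "cmod (f 0) \<le> \<delta>" "var \<sigma> f \<le> ennreal \<delta>"
    using zero_in by (auto intro: less_imp_le)
  from calculus_part_converges[OF AC_continuous_on[OF f] this] show ?thesis
    using calculus_eqI by metis
qed

text \<open>The algebraic identities pass to the limit from the truncations. Since
  \<open>calculus_eqI\<close> asks only for convergence, sums and products need not first be shown
  to lie in \<open>AC\<close>. Continuity is the norm estimate applied to g - f.\<close>

lemma calculus_AC_functional_calculus: "AC_functional_calculus \<sigma> calculus"
  unfolding AC_functional_calculus_def
proof (intro conjI ballI allI impI)
  fix f assume f: "f \<in> AC \<sigma>"
  note lim_f = calculus_part_AC[OF f]
  show "calculus f \<in> bounded_ops"
    by (rule lim_in_bounded_ops[OF calculus_part_bounded lim_f])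
  show "calculus (\<lambda>z. c * f z) = c *\<^sub>C calculus f" for c
    by (rule calculus_eqI) (simp add: calculus_part_scale tendsto_scaleC lim_f)
  fix g assume g: "g \<in> AC \<sigma>"
  note lim_g = calculus_part_AC[OF g]
  show "calculus (\<lambda>z. f z + g z) = calculus f + calculus g"
    by (rule calculus_eqI) (simp add: calculus_part_add tendsto_add lim_f lim_g)
  show "calculus (\<lambda>z. f z * g z) = calculus f o\<^sub>L calculus g"
    by (rule calculus_eqI)
      (simp add: calculus_part_mult bounded_bilinear.tendsto[OF bounded_bilinear_blinfun_compose]
        lim_f lim_g)
next
  show "calculus (restr \<sigma> (\<lambda>z. 1)) = id_blinfun"
    by (rule calculus_eqI) (simp add: calculus_part_one)
next
  fix f and \<epsilon> :: real assume f: "f \<in> AC \<sigma>" and "\<epsilon> > 0"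
  define C where "C = 1 + N * K"
  have "C > 0" using K_nonneg by (simp add: C_def add_pos_nonneg)
  show "\<exists>\<delta>>0. \<forall>g\<in>AC \<sigma>. BV_norm \<sigma> (\<lambda>z. g z - f z) < ennreal \<delta> \<longrightarrow>
      norm (calculus g - calculus f) < \<epsilon>"
  proof (intro exI conjI ballI impI)
    \<comment> \<open>The factor 2 turns the non-strict bound \<epsilon>/2 into a strict one by
      \<epsilon>.\<close>
    show "\<epsilon> / (2 * C) > 0" using \<open>\<epsilon> > 0\<close> \<open>C > 0\<close> by simp
    fix g assume g: "g \<in> AC \<sigma>" and small: "BV_norm \<sigma> (\<lambda>z. g z - f z) < ennreal (\<epsilon> / (2 * C))"
    have "continuous_on \<sigma> (\<lambda>z. g z - f z)"
      using AC_continuous_on f g by (intro continuous_on_diff)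
    moreover have "cmod (g 0 - f 0) \<le> \<epsilon> / (2 * C)"
      using BV_norm_bounds(1)[OF small zero_in] by (rule less_imp_le)
    moreover have "var \<sigma> (\<lambda>z. g z - f z) \<le> ennreal (\<epsilon> / (2 * C))"
      using BV_norm_bounds(2)[OF small] by (rule less_imp_le)
    ultimately obtain L where L: "(\<lambda>M. calculus_part M (\<lambda>z. g z - f z)) \<longlonglongrightarrow> L"
      "norm L \<le> C * (\<epsilon> / (2 * C))"
      unfolding C_def by (rule calculus_part_converges)
    have "(\<lambda>M. calculus_part M (\<lambda>z. g z - f z)) \<longlonglongrightarrow> calculus g - calculus f"
      by (simp add: calculus_part_diff tendsto_diff calculus_part_AC f g)
    with L have "norm (calculus g - calculus f) \<le> C * (\<epsilon> / (2 * C))"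
      using LIMSEQ_unique by blast
    then show "norm (calculus g - calculus f) < \<epsilon>" using \<open>\<epsilon> > 0\<close> \<open>C > 0\<close> by simp
  qed
qed

text \<open>Abel summation is applied directly to the eigenvalues: interleaving needs a sum for each
  ray separately, whereas \<open>calculus_part_converges\<close> only provides the limit over all
  rays together.\<close>

lemma eigenvalue_sums:
  assumes n: "n \<in> {1..N}"
  shows "(\<lambda>i. lam n (Suc i) *\<^sub>C E n (Suc i)) sums (\<Sum>i. lam n (Suc i) *\<^sub>C E n (Suc i))"
proof (intro summable_sums abel_summable(1)[OF _ _ partial_sums_bounded[OF n]])
  show null': "(\<lambda>i. lam n (Suc i)) \<longlonglongrightarrow> 0" by (rule LIMSEQ_Suc[OF null[OF n]])
  \<comment> \<open>Along a fixed direction with decreasing moduli, distances are differences of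
    moduli, so the variation telescopes.\<close>
  have "cmod (lam n (Suc (Suc i)) - lam n (Suc i)) =
      cmod (lam n (Suc i)) - cmod (lam n (Suc (Suc i)))" for i
  proof -
    let ?r = "\<lambda>i. cmod (lam n (Suc i))" and ?w = "exp (\<i> * complex_of_real (\<theta> n))"
    have "lam n (Suc (Suc i)) - lam n (Suc i) = complex_of_real (?r (Suc i) - ?r i) * ?w"
      using lam_polar[OF n, of "Suc i"] lam_polar[OF n, of "Suc (Suc i)"]
      by (metis left_diff_distrib le_add1 of_real_diff plus_1_eq_Suc)
    then have "cmod (lam n (Suc (Suc i)) - lam n (Suc i)) = \<bar>?r (Suc i) - ?r i\<bar>"
      by (simp only: norm_mult norm_of_real) simp
    then show ?thesis using decreasing[OF n, of "Suc i"] by simp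
  qed
  then show "summable (\<lambda>i. cmod (lam n (Suc (Suc i)) - lam n (Suc i)))"
    using telescope_summable'[OF tendsto_norm_zero[OF null']] by simp
qed

text \<open>The total of the ray sums is both the sum in the order of \<open>e\<close> and the value
  of the calculus at the identity function. The first description makes it a norm limit of finite
  rank operators, the second an AC operator.\<close>

lemma sums_compact_AC_operator:
  assumes e: "ordered_enumeration N lam \<theta> e"
  shows "\<exists>T. (\<lambda>k. lam (fst (e k)) (snd (e k)) *\<^sub>C E (fst (e k)) (snd (e k))) sums T \<and>
           compact_operator T \<and> AC_operator \<sigma> T"
proof (intro exI conjI)
  define T where "T = (\<Sum>n=1..N. \<Sum>i. lam n (Suc i) *\<^sub>C E n (Suc i))"
  show sums: "(\<lambda>k. lam (fst (e k)) (snd (e k)) *\<^sub>C E (fst (e k)) (snd (e k))) sums T"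
    unfolding T_def
    by (rule ordered_enumeration_sums[OF e, of "\<lambda>n m. lam n m *\<^sub>C E n m"]) (rule eigenvalue_sums)
  have eI: "fst (e k) \<in> {1..N}" "snd (e k) \<ge> 1" for k
  proof -
    have "e k \<in> {1..N} \<times> {1..}"
      using e rangeI[of e k] by (simp add: ordered_enumeration_def bij_betw_def)
    then show "fst (e k) \<in> {1..N}" "snd (e k) \<ge> 1" by auto
  qed
  show "compact_operator T"
    by (rule compact_operator_limit[OF _ _ sums[unfolded sums_def]])
      (intro sum_in_bounded_ops scaleC_in_bounded_ops E_bounded finite_rank_sum finite_rank_scaleC
        rank eI)+
  then have "T \<in> bounded_ops" by (simp add: compact_operator_def)
  moreover have "calculus (restr \<sigma> (\<lambda>z. z)) = T"
  proof -
    \<comment> \<open>The identity function vanishes at 0, so the multiple of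
      \<open>id_blinfun\<close> drops out and the coefficients are the eigenvalues
      themselves.\<close>
    have "(\<lambda>M. calculus_part M (restr \<sigma> (\<lambda>z. z))) \<longlonglongrightarrow> restr \<sigma> (\<lambda>z. z) 0 *\<^sub>C id_blinfun + T"
      unfolding T_def
      by (rule calculus_part_lim) (use eigenvalue_sums zero_in lam_in in \<open>simp add: restr_def\<close>)
    then show ?thesis by (intro calculus_eqI) (simp add: restr_def)
  qed
  ultimately show "AC_operator \<sigma> T"
    unfolding AC_operator_def using calculus_AC_functional_calculus by blast
qed

end

theorem theorem5p1:
  fixes N :: nat
    and \<theta> :: "nat \<Rightarrow> real"
    and lam :: "nat \<Rightarrow> nat \<Rightarrow> complex"
    and E :: "nat \<Rightarrow> nat \<Rightarrow> 'a::complex_banach \<Rightarrow>\<^sub>L 'a"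
    and \<sigma> :: "complex set"
  assumes "N \<ge> 1"
    and "\<forall>n\<in>{1..N}. \<theta> n \<in> {0..<2 * pi}" and "inj_on \<theta> {1..N}"
    and "\<forall>n\<in>{1..N}. \<forall>m\<ge>1. is_projection (E n m)"
    and "\<forall>n\<in>{1..N}. \<forall>m\<ge>1. lam n m \<in> ray (\<theta> n)"
    and "\<forall>n\<in>{1..N}. \<forall>m\<ge>1. cmod (lam n m) > cmod (lam n (Suc m))"
    and "\<forall>n\<in>{1..N}. lam n \<longlonglongrightarrow> 0"
    and "\<forall>p \<in> {1..N} \<times> {1..}. \<forall>q \<in> {1..N} \<times> {1..}. p \<noteq> q \<longrightarrow>
           disjoint_ops (E (fst p) (snd p)) (E (fst q) (snd q))"
    and "\<forall>n\<in>{1..N}. \<forall>m\<ge>1. finite_rank (E n m)"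
    and "\<exists>K. \<forall>n\<in>{1..N}. \<forall>M\<ge>1. norm (\<Sum>m=1..M. E n m) \<le> K"
    and "\<sigma> = {0} \<union> {lam n m | n m. n \<in> {1..N} \<and> m \<ge> 1}"
  shows "\<exists>e T. ordered_enumeration N lam \<theta> e \<and>
           (\<lambda>k. lam (fst (e k)) (snd (e k)) *\<^sub>C E (fst (e k)) (snd (e k))) sums T \<and>
           compact_operator T \<and> AC_operator \<sigma> T"
proof -
  obtain K where K: "\<forall>n\<in>{1..N}. \<forall>M\<ge>1. norm (\<Sum>m=1..M. E n m) \<le> K" using assms(10) ..
  interpret ray_projections N \<theta> lam E \<sigma> K
    by unfold_locales (rule assms(1,3,11) assms(4-9)[rule_format] K[rule_format]; assumption)+
  obtain e where "ordered_enumeration N lam \<theta> e" by (rule ex_ordered_enumeration)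
  then show ?thesis using sums_compact_AC_operator by blast
qed

end
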